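(* Let $H_1$ and $H_2$ be Hilbert spaces. Then the pair $(H_1\times H_2,\mathbb{K})$ has the Bishop-Phelps-Bollobás point property for bilinear forms.
   Context: All spaces are over the same scalar field $\mathbb{K}$, which is $\mathbb{R}$ or $\mathbb{C}$. $S_X$ and $B_X$ are the unit sphere and closed unit ball of $X$. For Banach spaces $X,Y,Z$, $B(X\times Y,Z)$ is the Banach space of bounded bilinear mappings from $X\times Y$ into $Z$ with norm $\|B\|=\sup\{\|B(x,y)\|:x\in B_X,\,y\in B_Y\}$. The pair $(X\times Y,Z)$ has the Bishop-Phelps-Bollobás point property (BPBpp) for bilinear mappings if for every $\varepsilon>0$ there exists $\eta(\varepsilon)>0$ such that whenever $B\in B(X\times Y,Z)$ with $\|B\|=1$ and $(x_0,y_0)\in S_X\times S_Y$ satisfy $\|B(x_0,y_0)\|>1-\eta(\varepsilon)$, there exists $A\in B(X\times Y,Z)$ with $\|A\|=1$ such that $\|A(x_0,y_0)\|=1$ and $\|A-B\|<\varepsilon$. When $Z=\mathbb{K}$ one says that $(X\times Y,\mathbb{K})$ has the BPBpp for bilinear forms. *)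

theory Defs
  imports "HOL-Analysis.Analysis"
begin

text \<open>
  Complex inner product spaces. The form is linear in the first argument. The scalar multiplication
  by complex numbers extends the real one carried by \<open>real_normed_vector\<close>, and the norm is the
  one induced by the inner product. Complex Hilbert spaces are the types of sort
  \<open>{complex_inner, banach}\<close>, real Hilbert spaces those of sort \<open>{real_inner, banach}\<close>.
\<close>

class complex_inner = real_normed_vector +
  fixes scaleC :: "complex \<Rightarrow> 'a \<Rightarrow> 'a"
    and cinner :: "'a \<Rightarrow> 'a \<Rightarrow> complex"
  assumes scaleC_add_right: "scaleC c (x + y) = scaleC c x + scaleC c y"
    and scaleC_add_left: "scaleC (c + d) x = scaleC c x + scaleC d x"
    and scaleC_scaleC: "scaleC c (scaleC d x) = scaleC (c * d) x"
    and scaleC_of_real: "scaleC (complex_of_real r) x = scaleR r x"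
    and cinner_commute: "cinner x y = cnj (cinner y x)"
    and cinner_add_left: "cinner (x + y) z = cinner x z + cinner y z"
    and cinner_scaleC_left: "cinner (scaleC c x) y = c * cinner x y"
    and cinner_ge_zero: "0 \<le> Re (cinner x x)"
    and cinner_eq_zero_iff: "cinner x x = 0 \<longleftrightarrow> x = 0"
    and norm_eq_sqrt_cinner: "norm x = sqrt (Re (cinner x x))"

instantiation complex :: complex_inner
begin

definition scaleC_complex :: "complex \<Rightarrow> complex \<Rightarrow> complex"
  where "scaleC_complex c x = c * x"

definition cinner_complex :: "complex \<Rightarrow> complex \<Rightarrow> complex"
  where "cinner_complex x y = x * cnj y"

instance
  by standard
    (simp_all add: scaleC_complex_def cinner_complex_def algebra_simps scaleR_conv_of_real
      cmod_def power2_eq_square)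

end

text \<open>
  The scalar multiplications of the three spaces are parameters, so that the same definitions serve
  for real and complex scalars. The predicate \<open>bounded_bilinear\<close> only provides homogeneity over the
  reals; for real scalars the extra conditions are redundant (see \<open>bounded_bilinear_maps_real\<close>).
\<close>

definition bounded_bilinear_maps ::
  "('k::real_normed_field \<Rightarrow> 'a::banach \<Rightarrow> 'a) \<Rightarrow> ('k \<Rightarrow> 'b::banach \<Rightarrow> 'b) \<Rightarrow>
    ('k \<Rightarrow> 'c::banach \<Rightarrow> 'c) \<Rightarrow> ('a \<Rightarrow> 'b \<Rightarrow> 'c) set"
  where "bounded_bilinear_maps sX sY sZ =
    {B. bounded_bilinear B \<and>
      (\<forall>c x y. B (sX c x) y = sZ c (B x y)) \<and>
      (\<forall>c x y. B x (sY c y) = sZ c (B x y))}"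

lemma bounded_bilinear_maps_real:
  "bounded_bilinear_maps scaleR scaleR scaleR = {B. bounded_bilinear B}"
  unfolding bounded_bilinear_maps_def
  by (auto simp: bounded_bilinear.scaleR_left bounded_bilinear.scaleR_right)

definition bilinear_norm ::
  "('a::real_normed_vector \<Rightarrow> 'b::real_normed_vector \<Rightarrow> 'c::real_normed_vector) \<Rightarrow> real"
  where "bilinear_norm B = Sup {norm (B x y) | x y. x \<in> cball 0 1 \<and> y \<in> cball 0 1}"

definition BPBpp ::
  "('k::real_normed_field \<Rightarrow> 'a::banach \<Rightarrow> 'a) \<Rightarrow> ('k \<Rightarrow> 'b::banach \<Rightarrow> 'b) \<Rightarrow>
    ('k \<Rightarrow> 'c::banach \<Rightarrow> 'c) \<Rightarrow> bool"
  where "BPBpp sX sY sZ \<longleftrightarrow>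
    (\<forall>\<epsilon>>0. \<exists>\<eta>>0.
      \<forall>B\<in>bounded_bilinear_maps sX sY sZ. \<forall>x0\<in>sphere 0 1. \<forall>y0\<in>sphere 0 1.
        bilinear_norm B = 1 \<and> norm (B x0 y0) > 1 - \<eta> \<longrightarrow>
        (\<exists>A\<in>bounded_bilinear_maps sX sY sZ.
          bilinear_norm A = 1 \<and> norm (A x0 y0) = 1 \<and>
          bilinear_norm (\<lambda>x y. A x y - B x y) < \<epsilon>))"

end

theory Submission
  imports Defs
begin

text \<open>
  Split each space as the line through the given unit vector plus its orthogonal complement, and
  write \<open>x = p x \<cdot> x\<^sub>0 + x'\<close>, \<open>y = q y \<cdot> y\<^sub>0 + y'\<close>. If \<open>B(x\<^sub>0,y\<^sub>0) = b\<close> with \<open>\<bar>b\<bar>\<close> close to 1, replace the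
  matrix entry \<open>b\<close> of \<open>B\<close> by the phase \<open>b/\<bar>b\<bar>\<close>, drop the two off-diagonal blocks and keep the last one:
  \<open>A(x,y) = (b/\<bar>b\<bar>) p(x) q(y) + B(x',y')\<close>.

  A block-diagonal form has norm the maximum of the norms of its blocks, by Cauchy--Schwarz and
  Pythagoras (\<open>norm_block_form_le\<close>), so \<open>A\<close> has norm one and attains it at \<open>(x\<^sub>0,y\<^sub>0)\<close>.
  The entry moves by \<open>1 - \<bar>b\<bar>\<close>. The deleted blocks \<open>B(x\<^sub>0,y')\<close> and \<open>B(x',y\<^sub>0)\<close> are small because a
  functional of norm at most one that nearly attains its norm at a unit vector is nearly zero on the
  orthogonal complement (\<open>norm_functional_complement_le\<close>): each has norm at most
  \<open>sqrt (1 - \<bar>b\<bar>\<^sup>2)\<close>.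

  Of the inner product only the coordinate functional \<open>p\<close> and the Pythagorean identity enter, which
  is what lets real and complex scalars be treated together.
\<close>

section \<open>The norm of a bilinear mapping\<close>

lemma norm_le_bilinear_norm:
  assumes "bounded_bilinear B"
  shows "norm (B x y) \<le> bilinear_norm B * (norm x * norm y)"
proof (cases "x = 0 \<or> y = 0")
  case True
  then show ?thesis
    by (auto simp: bounded_bilinear.zero_left[OF assms] bounded_bilinear.zero_right[OF assms])
next
  case False
  let ?S = "{norm (B x y) | x y. x \<in> cball 0 1 \<and> y \<in> cball 0 1}"
  obtain K where K: "0 \<le> K" "\<And>x y. norm (B x y) \<le> norm x * norm y * K"
    using bounded_bilinear.nonneg_bounded[OF assms] by blast
  have "bdd_above ?S"
  proof (rule bdd_aboveI)
    fix t assume "t \<in> ?S"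
    then obtain u v where uv: "t = norm (B u v)" "norm u \<le> 1" "norm v \<le> 1"
      by auto
    have "norm u * norm v * K \<le> 1 * 1 * K"
      using uv K(1) by (intro mult_mono) auto
    then show "t \<le> K" using K(2)[of u v] uv(1) by simp
  qed
  moreover have "norm (B (sgn x) (sgn y)) \<in> ?S"
    unfolding mem_Collect_eq using False
    by (intro exI[of _ "sgn x"] exI[of _ "sgn y"]) (simp add: norm_sgn)
  ultimately have "norm (B (sgn x) (sgn y)) \<le> bilinear_norm B"
    unfolding bilinear_norm_def by (rule cSup_upper[rotated])
  moreover have "B (sgn x) (sgn y) = (inverse (norm x) * inverse (norm y)) *\<^sub>R B x y"
    by (simp add: sgn_div_norm bounded_bilinear.scaleR_left[OF assms]
        bounded_bilinear.scaleR_right[OF assms])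
  ultimately show ?thesis
    using False by (simp add: field_simps)
qed

lemma bilinear_norm_le:
  assumes "0 \<le> K" and "\<And>x y. norm (B x y) \<le> K * (norm x * norm y)"
  shows "bilinear_norm B \<le> K"
  unfolding bilinear_norm_def
proof (rule cSup_least)
  have "norm (B 0 0) \<in> {norm (B x y) | x y. x \<in> cball 0 1 \<and> y \<in> cball 0 1}"
    unfolding mem_Collect_eq by (intro exI[of _ 0]) simp
  then show "{norm (B x y) | x y. x \<in> cball 0 1 \<and> y \<in> cball 0 1} \<noteq> {}"
    by blast
  fix t assume "t \<in> {norm (B x y) | x y. x \<in> cball 0 1 \<and> y \<in> cball 0 1}"
  then obtain u v where uv: "t = norm (B u v)" "norm u \<le> 1" "norm v \<le> 1"
    by auto
  have "K * (norm u * norm v) \<le> K * (1 * 1)"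
    using uv assms(1) by (intro mult_mono) auto
  then show "t \<le> K" using assms(2)[of u v] uv(1) by simp
qed

section \<open>Orthogonal splitting along a unit vector\<close>

text \<open>
  The functional \<open>p\<close> is the coordinate along \<open>e\<close>. The last axiom stands for orthogonality of the
  decomposition and, together with \<open>p e = 1\<close>, makes \<open>e\<close> a unit vector.
\<close>

locale orthogonal_splitting = vector_space s
  for s :: "'k::real_normed_field \<Rightarrow> 'a::real_normed_vector \<Rightarrow> 'a" +
  fixes e :: 'a and p :: "'a \<Rightarrow> 'k"
  assumes scale_of_real: "s (of_real r) x = r *\<^sub>R x"
    and norm_scale: "norm (s c x) = norm c * norm x"
    and coord_add: "p (x + y) = p x + p y"
    and coord_scale: "p (s c x) = c * p x"
    and coord_axis: "p e = 1"
    and pythagoras: "(norm x)\<^sup>2 = (norm (p x))\<^sup>2 + (norm (x - s (p x) e))\<^sup>2"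
begin

definition resid :: "'a \<Rightarrow> 'a"
  where "resid x = x - s (p x) e"

lemma split_eq: "x = s (p x) e + resid x"
  by (simp add: resid_def)

lemma resid_add: "resid (x + y) = resid x + resid y"
  by (simp add: resid_def coord_add scale_left_distrib)

lemma resid_scale: "resid (s c x) = s c (resid x)"
  by (simp add: resid_def coord_scale scale_right_diff_distrib)

lemma resid_axis: "resid e = 0"
  by (simp add: resid_def coord_axis)

lemma coord_resid: "p (resid x) = 0"
  using arg_cong[OF split_eq[of x], of p] by (simp add: coord_add coord_scale coord_axis)

lemma pythagoras_resid: "(norm x)\<^sup>2 = (norm (p x))\<^sup>2 + (norm (resid x))\<^sup>2"
  unfolding resid_def by (rule pythagoras)

lemma norm_coord_le: "norm (p x) \<le> norm x"
  by (rule power2_le_imp_le) (simp_all add: pythagoras_resid[of x])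

lemma norm_resid_le: "norm (resid x) \<le> norm x"
  by (rule power2_le_imp_le) (simp_all add: pythagoras_resid[of x])

end

text \<open>The conjugate, obtained without one being given on the field.\<close>

lemma conjugate_exists:
  fixes z :: "'k::real_normed_field"
  obtains c where "c * z = of_real ((norm z)\<^sup>2)" "norm c = norm z"
proof (cases "z = 0")
  case True
  then show ?thesis using that[of 0] by simp
next
  case False
  then show ?thesis
    using that[of "of_real ((norm z)\<^sup>2) / z"] by (simp add: norm_divide norm_mult power2_eq_square)
qed

context orthogonal_splitting
begin

text \<open>
  Bessel's inequality for the vector representing \<open>f\<close>. Instead of that vector itself, its
  projection to the plane of \<open>e\<close> and \<open>y\<close>, up to a factor, is used as a test vector: \<open>f\<close> takes
  there the value \<open>S = N \<bar>f e\<bar>\<^sup>2 + \<bar>f y\<bar>\<^sup>2\<close>, while its squared norm is \<open>N S\<close>, where \<open>N\<close> is the squared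
  norm of \<open>y\<close>.
\<close>

lemma norm_functional_complement_le:
  fixes f :: "'a \<Rightarrow> 'k"
  assumes add: "\<And>x y. f (x + y) = f x + f y" and scale: "\<And>c x. f (s c x) = c * f x"
    and contraction: "\<And>x. norm (f x) \<le> norm x" and "p y = 0"
  shows "norm (f y) \<le> sqrt (1 - (norm (f e))\<^sup>2) * norm y"
proof -
  obtain c where c: "c * f e = of_real ((norm (f e))\<^sup>2)" "norm c = norm (f e)"
    by (rule conjugate_exists)
  obtain d where d: "d * f y = of_real ((norm (f y))\<^sup>2)" "norm d = norm (f y)"
    by (rule conjugate_exists)
  define N where "N = (norm y)\<^sup>2"
  define S where "S = N * (norm (f e))\<^sup>2 + (norm (f y))\<^sup>2"
  define z where "z = s (of_real N * c) e + s d y"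
  have N0: "0 \<le> N" and S0: "0 \<le> S"
    by (auto simp: N_def S_def)
  have pz: "p z = of_real N * c"
    by (simp add: z_def coord_add coord_scale coord_axis assms(4))
  have rz: "z - s (p z) e = s d y"
    unfolding pz by (simp add: z_def)
  have "(norm z)\<^sup>2 = N * S"
    using pythagoras[of z] unfolding rz unfolding pz
    by (simp add: norm_scale norm_mult c d power_mult_distrib N_def S_def algebra_simps
        power2_eq_square)
  moreover have "f z = of_real S"
    by (simp add: z_def add scale mult.assoc c d S_def)
  ultimately have "S\<^sup>2 \<le> N * S"
    using power_mono[OF contraction[of z], of 2] by simp
  then have "S \<le> N"
    using N0 S0 by (cases "S = 0") (auto simp: power2_eq_square)
  then have "(norm (f y))\<^sup>2 \<le> (1 - (norm (f e))\<^sup>2) * (norm y)\<^sup>2"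
    by (simp add: S_def N_def algebra_simps)
  then have "sqrt ((norm (f y))\<^sup>2) \<le> sqrt ((1 - (norm (f e))\<^sup>2) * (norm y)\<^sup>2)"
    by (rule real_sqrt_le_mono)
  then show ?thesis by (simp add: real_sqrt_mult)
qed

end

section \<open>Approximation by block-diagonal forms\<close>

lemma cauchy_schwarz_plane:
  fixes a b c d :: real
  assumes "m\<^sup>2 = a\<^sup>2 + b\<^sup>2" "n\<^sup>2 = c\<^sup>2 + d\<^sup>2" "0 \<le> m" "0 \<le> n"
  shows "a * c + b * d \<le> m * n"
proof (rule power2_le_imp_le)
  have "(m * n)\<^sup>2 - (a * c + b * d)\<^sup>2 = (a * d - b * c)\<^sup>2"
    unfolding power_mult_distrib assms(1,2) by (simp add: power2_eq_square algebra_simps)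
  then show "(a * c + b * d)\<^sup>2 \<le> (m * n)\<^sup>2"
    using zero_le_power2[of "a * d - b * c"] by linarith
qed (use assms in simp)

locale two_splittings =
  X: orthogonal_splitting sX x0 p + Y: orthogonal_splitting sY y0 q
  for sX :: "'k::{real_normed_field, banach} \<Rightarrow> 'a::banach \<Rightarrow> 'a" and x0 p
    and sY :: "'k \<Rightarrow> 'b::banach \<Rightarrow> 'b" and y0 q +
  fixes B :: "'a \<Rightarrow> 'b \<Rightarrow> 'k"
  assumes form: "B \<in> bounded_bilinear_maps sX sY (*)" and norm_form: "bilinear_norm B = 1"
begin

lemma bounded_bilinear_form: "bounded_bilinear B"
  and form_scale_left: "B (sX c x) y = c * B x y"
  and form_scale_right: "B x (sY c y) = c * B x y"
  using form by (auto simp: bounded_bilinear_maps_def)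

lemmas form_add_left = bounded_bilinear.add_left[OF bounded_bilinear_form]
lemmas form_add_right = bounded_bilinear.add_right[OF bounded_bilinear_form]

lemma norm_form_le: "norm (B x y) \<le> norm x * norm y"
  using norm_le_bilinear_norm[OF bounded_bilinear_form, of x y] by (simp add: norm_form)

lemma norm_axis: "norm x0 = 1" "norm y0 = 1"
  using X.pythagoras_resid[of x0] Y.pythagoras_resid[of y0]
  by (auto simp: X.resid_axis Y.resid_axis X.coord_axis Y.coord_axis dest!: power_eq_1_iff)

definition block_form :: "'k \<Rightarrow> 'a \<Rightarrow> 'b \<Rightarrow> 'k"
  where "block_form \<mu> x y = \<mu> * p x * q y + B (X.resid x) (Y.resid y)"

lemma block_form_axis: "block_form \<mu> x0 y0 = \<mu>"
  by (simp add: block_form_def X.coord_axis Y.coord_axis X.resid_axis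
      bounded_bilinear.zero_left[OF bounded_bilinear_form])

lemma norm_block_form_le:
  assumes "norm \<mu> = 1"
  shows "norm (block_form \<mu> x y) \<le> norm x * norm y"
proof -
  have "norm (block_form \<mu> x y)
      \<le> norm (p x) * norm (q y) + norm (X.resid x) * norm (Y.resid y)"
    unfolding block_form_def
    by (rule norm_triangle_le) (use norm_form_le in \<open>simp add: norm_mult assms\<close>)
  also have "\<dots> \<le> norm x * norm y"
    by (rule cauchy_schwarz_plane[OF X.pythagoras_resid Y.pythagoras_resid norm_ge_zero norm_ge_zero])
  finally show ?thesis .
qed

lemma block_form_bounded_bilinear_maps:
  assumes "norm \<mu> = 1"
  shows "block_form \<mu> \<in> bounded_bilinear_maps sX sY (*)"
proof -
  have scale: "block_form \<mu> (sX c x) y = c * block_form \<mu> x y"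
    "block_form \<mu> x (sY c y) = c * block_form \<mu> x y" for c x y
    by (simp_all add: block_form_def X.coord_scale Y.coord_scale X.resid_scale Y.resid_scale
        form_scale_left form_scale_right algebra_simps)
  have "bounded_bilinear (block_form \<mu>)"
  proof
    show "block_form \<mu> (x + x') y = block_form \<mu> x y + block_form \<mu> x' y" for x x' y
      by (simp add: block_form_def X.coord_add X.resid_add form_add_left algebra_simps)
    show "block_form \<mu> x (y + y') = block_form \<mu> x y + block_form \<mu> x y'" for x y y'
      by (simp add: block_form_def Y.coord_add Y.resid_add form_add_right algebra_simps)
    show "block_form \<mu> (r *\<^sub>R x) y = r *\<^sub>R block_form \<mu> x y" for r x y
      using scale(1)[of "of_real r" x y] by (simp add: X.scale_of_real scaleR_conv_of_real)
    show "block_form \<mu> x (r *\<^sub>R y) = r *\<^sub>R block_form \<mu> x y" for r x y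
      using scale(2)[of x "of_real r" y] by (simp add: Y.scale_of_real scaleR_conv_of_real)
    show "\<exists>K. \<forall>x y. norm (block_form \<mu> x y) \<le> norm x * norm y * K"
      using norm_block_form_le[OF assms] by (intro exI[of _ 1]) simp
  qed
  then show ?thesis
    using scale by (simp add: bounded_bilinear_maps_def)
qed

lemma bilinear_norm_block_form:
  assumes "norm \<mu> = 1"
  shows "bilinear_norm (block_form \<mu>) = 1"
proof (rule antisym)
  show "bilinear_norm (block_form \<mu>) \<le> 1"
    by (rule bilinear_norm_le) (use norm_block_form_le[OF assms] in auto)
  show "1 \<le> bilinear_norm (block_form \<mu>)"
    using norm_le_bilinear_norm[of "block_form \<mu>" x0 y0] block_form_bounded_bilinear_maps[OF assms]
    by (simp add: bounded_bilinear_maps_def block_form_axis norm_axis assms)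
qed

text \<open>
  The three terms are the change of the diagonal entry and the two deleted blocks.
\<close>

lemma block_form_diff:
  "block_form \<mu> x y - B x y =
    (\<mu> - B x0 y0) * p x * q y - p x * B x0 (Y.resid y) - q y * B (X.resid x) y0"
proof -
  have "B x y = B (sX (p x) x0 + X.resid x) (sY (q y) y0 + Y.resid y)"
    by (simp flip: X.split_eq Y.split_eq)
  then show ?thesis
    unfolding block_form_def form_add_left form_add_right form_scale_left form_scale_right
    by (simp add: algebra_simps)
qed

lemma bilinear_norm_block_form_diff_le:
  defines "\<beta> \<equiv> norm (B x0 y0)"
  shows "bilinear_norm (\<lambda>x y. block_form \<mu> x y - B x y)
    \<le> norm (\<mu> - B x0 y0) + 2 * sqrt (1 - \<beta>\<^sup>2)"
proof -
  let ?r = "sqrt (1 - \<beta>\<^sup>2)"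
  have "\<beta> \<le> 1"
    using norm_form_le[of x0 y0] by (simp add: \<beta>_def norm_axis)
  then have r0: "0 \<le> ?r"
    by (simp add: \<beta>_def power_le_one)
  have off_right: "norm (B x0 (Y.resid y)) \<le> ?r * norm y" for y
  proof -
    have "norm (B x0 (Y.resid y)) \<le> ?r * norm (Y.resid y)"
      unfolding \<beta>_def
      by (rule Y.norm_functional_complement_le)
        (use norm_form_le[of x0] in
          \<open>auto simp: form_add_right form_scale_right norm_axis Y.coord_resid\<close>)
    also have "\<dots> \<le> ?r * norm y"
      by (rule mult_left_mono[OF Y.norm_resid_le r0])
    finally show ?thesis .
  qed
  have off_left: "norm (B (X.resid x) y0) \<le> ?r * norm x" for x
  proof -
    have "norm (B (X.resid x) y0) \<le> ?r * norm (X.resid x)"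
      unfolding \<beta>_def
      by (rule X.norm_functional_complement_le)
        (use norm_form_le[of _ y0] in
          \<open>auto simp: form_add_left form_scale_left norm_axis X.coord_resid\<close>)
    also have "\<dots> \<le> ?r * norm x"
      by (rule mult_left_mono[OF X.norm_resid_le r0])
    finally show ?thesis .
  qed
  show ?thesis
  proof (rule bilinear_norm_le)
    show "0 \<le> norm (\<mu> - B x0 y0) + 2 * ?r"
      using r0 by simp
    fix x y
    have "norm (block_form \<mu> x y - B x y)
      \<le> norm ((\<mu> - B x0 y0) * p x * q y) + norm (p x * B x0 (Y.resid y))
          + norm (q y * B (X.resid x) y0)"
      unfolding block_form_diff
      by (rule order_trans[OF norm_triangle_ineq4]) (simp add: norm_triangle_ineq4)
    also have "\<dots> = norm (\<mu> - B x0 y0) * (norm (p x) * norm (q y))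
          + norm (p x) * norm (B x0 (Y.resid y)) + norm (q y) * norm (B (X.resid x) y0)"
      by (simp add: norm_mult)
    also have "\<dots> \<le> norm (\<mu> - B x0 y0) * (norm x * norm y)
          + norm x * (?r * norm y) + norm y * (?r * norm x)"
      using r0 X.norm_coord_le Y.norm_coord_le off_left off_right
      by (intro add_mono mult_mono) auto
    also have "\<dots> = (norm (\<mu> - B x0 y0) + 2 * ?r) * (norm x * norm y)"
      by (simp add: algebra_simps)
    finally show "norm (block_form \<mu> x y - B x y)
      \<le> (norm (\<mu> - B x0 y0) + 2 * ?r) * (norm x * norm y)" .
  qed
qed

text \<open>
  A defect below \<open>\<delta>\<^sup>2\<close> in the value at \<open>(x\<^sub>0,y\<^sub>0)\<close> costs at most \<open>\<delta>\<^sup>2 \<le> \<delta>\<close> on the diagonal, and at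
  most \<open>sqrt (2\<delta>\<^sup>2) \<le> 2\<delta>\<close> for each of the two deleted blocks; hence the factor 5. The square root
  is the reason for measuring the defect by a square.
\<close>

lemma norm_attaining_approximation:
  assumes "0 < \<delta>" "\<delta> \<le> 1" "norm (B x0 y0) > 1 - \<delta>\<^sup>2"
  shows "\<exists>A\<in>bounded_bilinear_maps sX sY (*). bilinear_norm A = 1 \<and> norm (A x0 y0) = 1 \<and>
    bilinear_norm (\<lambda>x y. A x y - B x y) \<le> 5 * \<delta>"
proof -
  define \<beta> where "\<beta> = norm (B x0 y0)"
  define \<mu> where "\<mu> = B x0 y0 / of_real \<beta>"
  have \<delta>2: "\<delta>\<^sup>2 \<le> \<delta>"
    using assms by (simp add: power2_eq_square)
  then have \<beta>0: "0 < \<beta>"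
    using assms unfolding \<beta>_def by linarith
  have \<beta>1: "\<beta> \<le> 1"
    using norm_form_le[of x0 y0] by (simp add: \<beta>_def norm_axis)
  have \<mu>1: "norm \<mu> = 1"
    using \<beta>0 by (simp add: \<mu>_def norm_divide) (simp add: \<beta>_def)
  have "\<mu> - B x0 y0 = \<mu> * of_real (1 - \<beta>)"
    using \<beta>0 by (simp add: \<mu>_def field_simps)
  then have "norm (\<mu> - B x0 y0) = 1 - \<beta>"
    using \<beta>1 by (simp add: norm_mult \<mu>1 del: of_real_diff)
  then have diag: "norm (\<mu> - B x0 y0) \<le> \<delta>"
    using assms(3) \<delta>2 by (simp add: \<beta>_def)
  have "1 - \<beta>\<^sup>2 = (1 - \<beta>) * (1 + \<beta>)"
    by (simp add: power2_eq_square algebra_simps)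
  also have "\<dots> \<le> \<delta>\<^sup>2 * 2"
    using assms(3) \<beta>0 \<beta>1 by (intro mult_mono) (auto simp: \<beta>_def)
  also have "\<dots> \<le> (2 * \<delta>)\<^sup>2"
    by (simp add: power_mult_distrib)
  finally have "sqrt (1 - \<beta>\<^sup>2) \<le> 2 * \<delta>"
    using assms(1) by (intro real_le_lsqrt) auto
  then have "bilinear_norm (\<lambda>x y. block_form \<mu> x y - B x y) \<le> 5 * \<delta>"
    using bilinear_norm_block_form_diff_le[of \<mu>] diag unfolding \<beta>_def by linarith
  then show ?thesis
    using block_form_bounded_bilinear_maps[OF \<mu>1] bilinear_norm_block_form[OF \<mu>1]
      block_form_axis[of \<mu>] \<mu>1
    by (intro bexI[of _ "block_form \<mu>"]) auto
qed

end

lemma BPBpp_if_splittings: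
  fixes sX :: "'k::{real_normed_field, banach} \<Rightarrow> 'a::banach \<Rightarrow> 'a"
    and sY :: "'k \<Rightarrow> 'b::banach \<Rightarrow> 'b"
  assumes X: "\<And>e. norm e = 1 \<Longrightarrow> orthogonal_splitting sX e (\<lambda>x. ipX x e)"
    and Y: "\<And>e. norm e = 1 \<Longrightarrow> orthogonal_splitting sY e (\<lambda>y. ipY y e)"
  shows "BPBpp sX sY ((*) :: 'k \<Rightarrow> 'k \<Rightarrow> 'k)"
  unfolding BPBpp_def
proof (intro allI impI)
  fix \<epsilon> :: real assume "0 < \<epsilon>"
  define \<delta> where "\<delta> = min 1 (\<epsilon> / 6)"
  have \<delta>: "0 < \<delta>" "\<delta> \<le> 1" "5 * \<delta> < \<epsilon>"
    using \<open>0 < \<epsilon>\<close> by (auto simp: \<delta>_def min_def)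
  show "\<exists>\<eta>>0. \<forall>B\<in>bounded_bilinear_maps sX sY (*). \<forall>x0\<in>sphere 0 1. \<forall>y0\<in>sphere 0 1.
        bilinear_norm B = 1 \<and> norm (B x0 y0) > 1 - \<eta> \<longrightarrow>
        (\<exists>A\<in>bounded_bilinear_maps sX sY (*).
          bilinear_norm A = 1 \<and> norm (A x0 y0) = 1 \<and>
          bilinear_norm (\<lambda>x y. A x y - B x y) < \<epsilon>)"
  proof (intro exI[of _ "\<delta>\<^sup>2"] conjI ballI impI)
    show "0 < \<delta>\<^sup>2" using \<delta> by simp
    fix B :: "'a \<Rightarrow> 'b \<Rightarrow> 'k" and x0 y0
    assume B: "B \<in> bounded_bilinear_maps sX sY (*)" and "x0 \<in> sphere 0 1" "y0 \<in> sphere 0 1"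
      and near: "bilinear_norm B = 1 \<and> norm (B x0 y0) > 1 - \<delta>\<^sup>2"
    then have "norm x0 = 1" "norm y0 = 1" by auto
    then interpret two_splittings sX x0 "\<lambda>x. ipX x x0" sY y0 "\<lambda>y. ipY y y0" B
      using X Y B near by (auto intro!: two_splittings.intro two_splittings_axioms.intro)
    show "\<exists>A\<in>bounded_bilinear_maps sX sY (*). bilinear_norm A = 1 \<and> norm (A x0 y0) = 1 \<and>
        bilinear_norm (\<lambda>x y. A x y - B x y) < \<epsilon>"
      using norm_attaining_approximation[OF \<delta>(1,2)] near \<delta>(3) by fastforce
  qed
qed

section \<open>Real and complex inner product spaces\<close>

lemma orthogonal_splitting_inner:
  fixes e :: "'a::real_inner"
  assumes "norm e = 1"
  shows "orthogonal_splitting scaleR e (\<lambda>x. inner x e)"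
proof
  have ee: "inner e e = 1"
    using assms by (simp add: norm_eq_1)
  then show "inner e e = 1" .
  show "(norm x)\<^sup>2 = (norm (inner x e))\<^sup>2 + (norm (x - inner x e *\<^sub>R e))\<^sup>2" for x
    by (simp add: power2_norm_eq_inner inner_diff_left inner_diff_right ee inner_commute[of e x])
      (simp add: power2_eq_square)
qed (simp_all add: algebra_simps inner_add_left)

lemma cinner_add_right: "cinner x (y + z) = cinner x y + cinner x z"
  by (metis cinner_commute cinner_add_left complex_cnj_add)

lemma cinner_scaleC_right: "cinner x (scaleC c y) = cnj c * cinner x y"
  by (metis cinner_commute cinner_scaleC_left complex_cnj_mult)

lemma cinner_self: "cinner x x = complex_of_real ((norm x)\<^sup>2)"
proof -
  have "Im (cinner x x) = 0"
    using arg_cong[OF cinner_commute[of x x], of Im] by simp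
  then show ?thesis
    using cinner_ge_zero[of x] by (simp add: norm_eq_sqrt_cinner complex_eq_iff)
qed

lemma norm_scaleC: "norm (scaleC c x) = cmod c * norm x"
proof -
  have "complex_of_real ((norm (scaleC c x))\<^sup>2) = complex_of_real ((cmod c * norm x)\<^sup>2)"
    unfolding cinner_self[symmetric] cinner_scaleC_left cinner_scaleC_right
    by (simp add: cinner_self power_mult_distrib complex_norm_square del: of_real_power)
  then show ?thesis
    by (simp only: of_real_eq_iff) simp
qed

lemma orthogonal_splitting_cinner:
  fixes e :: "'a::complex_inner"
  assumes "norm e = 1"
  shows "orthogonal_splitting scaleC e (\<lambda>x. cinner x e)"
proof
  have ee: "cinner e e = 1"
    using assms by (simp add: cinner_self)
  then show "cinner e e = 1" .
  show "scaleC 1 x = x" for x :: 'a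
    using scaleC_of_real[of 1 x] by simp
  show "(norm x)\<^sup>2 = (norm (cinner x e))\<^sup>2 + (norm (x - scaleC (cinner x e) e))\<^sup>2" for x
  proof -
    define c where "c = cinner x e"
    define r where "r = x - scaleC c e"
    have x: "x = scaleC c e + r"
      by (simp add: r_def)
    have "cinner r e = 0"
      using arg_cong[OF x, of "\<lambda>v. cinner v e"]
      by (simp add: cinner_add_left cinner_scaleC_left ee flip: c_def)
    moreover from this have "cinner e r = 0"
      using cinner_commute[of e r] by simp
    ultimately have "cinner x x = c * cnj c + cinner r r"
      by (subst (1 2) x)
        (simp add: cinner_add_left cinner_add_right cinner_scaleC_left cinner_scaleC_right ee)
    then have "complex_of_real ((norm x)\<^sup>2) = complex_of_real ((cmod c)\<^sup>2 + (norm r)\<^sup>2)"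
      by (simp add: cinner_self complex_norm_square del: of_real_power)
    then show ?thesis
      unfolding r_def c_def of_real_eq_iff .
  qed
qed (simp_all add: scaleC_add_right scaleC_add_left scaleC_scaleC scaleC_of_real norm_scaleC
    cinner_add_left cinner_scaleC_left)

theorem corollary3p2:
  shows "BPBpp (scaleR :: real \<Rightarrow> 'a::{real_inner, banach} \<Rightarrow> 'a)
           (scaleR :: real \<Rightarrow> 'b::{real_inner, banach} \<Rightarrow> 'b)
           ((*) :: real \<Rightarrow> real \<Rightarrow> real) \<and>
         BPBpp (scaleC :: complex \<Rightarrow> 'c::{complex_inner, banach} \<Rightarrow> 'c)
           (scaleC :: complex \<Rightarrow> 'd::{complex_inner, banach} \<Rightarrow> 'd)
           ((*) :: complex \<Rightarrow> complex \<Rightarrow> complex)"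
  using BPBpp_if_splittings[OF orthogonal_splitting_inner orthogonal_splitting_inner]
    BPBpp_if_splittings[OF orthogonal_splitting_cinner orthogonal_splitting_cinner]
  by blast

end
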